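(* Let $\{\Lambda_i'\}_{i=1}^n$ and $\{\Lambda_i\}_{i=1}^n$ be two sets of convex generators such that the $\Lambda_i'$ have no hyperbolic orbit in common (pairwise, for distinct indices) and the $\Lambda_i$ have no hyperbolic orbit in common (pairwise, for distinct indices). Suppose that for any $1\le i\le n$, $$I(\Lambda_i)=I(\Lambda_i'),$$ and moreover that, for any $i\ne j$, $$I(\Lambda_i\cdot\Lambda_j)=I(\Lambda_i'\cdot\Lambda_j').$$ Then, for any subset $S\subseteq\{1,2,\dots,n\}$, $$I\Big(\prod_{i\in S}\Lambda_i\Big)=I\Big(\prod_{i\in S}\Lambda_i'\Big).$$
   Context: A convex integral path $\Lambda$ is a path in $\mathbb{R}^2$ with endpoints $(0,y(\Lambda))$ and $(x(\Lambda),0)$, where $x(\Lambda),y(\Lambda)$ are nonnegative integers, which is the graph of a piecewise linear concave function $f:[0,x(\Lambda)]\to[0,y(\Lambda)]$ with $f'(0)\le0$, possibly together with a vertical segment at the right, and whose vertices (points where the slope changes) are lattice points. A convex generator is a convex integral path each of whose edges (segments between consecutive vertices) is labelled $e$ or $h$, where horizontal and vertical edges can only be labelled $e$. For coprime nonnegative integers $a,b$ and a positive integer $m$, $e_{a,b}^m$ denotes an edge labelled $e$ with displacement vector $(ma,-mb)$, and $e_{a,b}^{m-1}h_{a,b}$ denotes an edge labelled $h$ with displacement vector $(ma,-mb)$. A convex generator is thus identified with a commutative formal product of symbols $e_{a,b}$ and $h_{a,b}$, with no $h_{a,b}$ repeated and no $h_{1,0}$ or $h_{0,1}$. The empty product $1$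 is the path with no edges at $(0,0)$. Two generators have no hyperbolic orbit in common if no factor $h_{a,b}$ appears in both of their formal products. For such generators the product is the convex generator given by concatenating the formal products; this operation is associative whenever defined. $L(\Lambda)$ is the number of lattice points in the closed region bounded by $\Lambda$ and the axes (boundary included), $h(\Lambda)$ is the number of edges labelled $h$, and $I(\Lambda)=2(L(\Lambda)-1)-h(\Lambda)$. *)

theory Defs
  imports "HOL-Analysis.Analysis" "HOL-Library.Multiset"
begin

text \<open>
  The symbols \<open>e\<^sub>a\<^sub>,\<^sub>b\<close> (elliptic) and \<open>h\<^sub>a\<^sub>,\<^sub>b\<close> (hyperbolic). Commutative formal products of symbols are
  multisets; hence the empty product is \<open>{#}\<close>, the product of two formal products is \<open>+\<close>, and the
  product of a finite family is \<open>\<Sum>\<close>.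
\<close>

datatype orbit = Ell nat nat | Hyp nat nat

type_synonym formal_product = "orbit multiset"

definition convex_generator :: "formal_product \<Rightarrow> bool" where
  "convex_generator \<Lambda> \<longleftrightarrow>
     (\<forall>a b. Ell a b \<in># \<Lambda> \<longrightarrow> coprime a b) \<and>
     (\<forall>a b. Hyp a b \<in># \<Lambda> \<longrightarrow> coprime a b \<and> count \<Lambda> (Hyp a b) = 1) \<and>
     Hyp 1 0 \<notin># \<Lambda> \<and> Hyp 0 1 \<notin># \<Lambda>"

definition no_common_hyperbolic :: "formal_product \<Rightarrow> formal_product \<Rightarrow> bool" where
  "no_common_hyperbolic \<Lambda> \<Lambda>' \<longleftrightarrow> \<not> (\<exists>a b. Hyp a b \<in># \<Lambda> \<and> Hyp a b \<in># \<Lambda>')"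

text \<open>
  Every direction \<open>(a, b)\<close> occurring in \<open>\<Lambda>\<close> contributes a single edge, with displacement
  \<open>(m a, -m b)\<close>, where \<open>m\<close> is the total exponent of \<open>e\<^sub>a\<^sub>,\<^sub>b\<close> and \<open>h\<^sub>a\<^sub>,\<^sub>b\<close>. The edge is labelled \<open>h\<close>
  iff \<open>h\<^sub>a\<^sub>,\<^sub>b\<close> is a factor.
\<close>

definition edge_dirs :: "formal_product \<Rightarrow> (nat \<times> nat) set" where
  "edge_dirs \<Lambda> = {(a, b). Ell a b \<in># \<Lambda> \<or> Hyp a b \<in># \<Lambda>}"

definition edge_mult :: "formal_product \<Rightarrow> nat \<times> nat \<Rightarrow> nat" where
  "edge_mult \<Lambda> = (\<lambda>(a, b). count \<Lambda> (Ell a b) + count \<Lambda> (Hyp a b))"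

definition h_edges :: "formal_product \<Rightarrow> (nat \<times> nat) set" where
  "h_edges \<Lambda> = {(a, b) \<in> edge_dirs \<Lambda>. Hyp a b \<in># \<Lambda>}"

text \<open>The slopes satisfy \<open>-b/a > -b'/a'\<close>, a vertical edge having slope \<open>-\<infinity>\<close>.\<close>

definition flatter :: "nat \<times> nat \<Rightarrow> nat \<times> nat \<Rightarrow> bool" where
  "flatter = (\<lambda>(a, b) (a', b'). b * a' < b' * a)"

definition path_x :: "formal_product \<Rightarrow> nat" where
  "path_x \<Lambda> = (\<Sum>d\<in>edge_dirs \<Lambda>. edge_mult \<Lambda> d * fst d)"

definition path_y :: "formal_product \<Rightarrow> nat" where
  "path_y \<Lambda> = (\<Sum>d\<in>edge_dirs \<Lambda>. edge_mult \<Lambda> d * snd d)"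

text \<open>
  Concavity forces the edges to be traversed in order of decreasing slope, starting from
  \<open>(0, y(\<Lambda>))\<close>: the initial point of an edge has moved right by all flatter edges, and the edge itself
  and all steeper ones still lie between it and the horizontal axis.
\<close>

definition edge_start :: "formal_product \<Rightarrow> nat \<times> nat \<Rightarrow> real \<times> real" where
  "edge_start \<Lambda> d =
     (real (\<Sum>c | c \<in> edge_dirs \<Lambda> \<and> flatter c d. edge_mult \<Lambda> c * fst c),
      real (\<Sum>c | c \<in> edge_dirs \<Lambda> \<and> \<not> flatter c d. edge_mult \<Lambda> c * snd c))"

definition edge_vec :: "formal_product \<Rightarrow> nat \<times> nat \<Rightarrow> real \<times> real" where
  "edge_vec \<Lambda> d = (real (edge_mult \<Lambda> d * fst d), - real (edge_mult \<Lambda> d * snd d))"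

text \<open>The initial point is inserted only because of the empty product, whose path is \<open>{(0, 0)}\<close>.\<close>

definition path_of :: "formal_product \<Rightarrow> (real \<times> real) set" where
  "path_of \<Lambda> = insert (0, real (path_y \<Lambda>))
     (\<Union>d\<in>edge_dirs \<Lambda>. closed_segment (edge_start \<Lambda> d) (edge_start \<Lambda> d + edge_vec \<Lambda> d))"

definition region :: "formal_product \<Rightarrow> (real \<times> real) set" where
  "region \<Lambda> = {(x, y). 0 \<le> x \<and> 0 \<le> y \<and> (\<exists>y'\<ge>y. (x, y') \<in> path_of \<Lambda>)}"

definition lattice_count :: "formal_product \<Rightarrow> nat" where
  "lattice_count \<Lambda> = card {(i :: int, j :: int). (real_of_int i, real_of_int j) \<in> region \<Lambda>}"

definition ech_index :: "formal_product \<Rightarrow> int" where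
  "ech_index \<Lambda> = 2 * (int (lattice_count \<Lambda>) - 1) - int (card (h_edges \<Lambda>))"

lemma convex_generator_empty: "convex_generator {#}"
  by (simp add: convex_generator_def)

lemma convex_generator_add:
  assumes "convex_generator \<Lambda>" "convex_generator \<Lambda>'" "no_common_hyperbolic \<Lambda> \<Lambda>'"
  shows "convex_generator (\<Lambda> + \<Lambda>')"
  using assms unfolding convex_generator_def no_common_hyperbolic_def
  by (auto simp: not_in_iff) (meson not_in_iff)+

lemma convex_generator_sum:
  assumes "finite S" "\<And>i. i \<in> S \<Longrightarrow> convex_generator (\<Lambda> i)"
    and "\<And>i j. i \<in> S \<Longrightarrow> j \<in> S \<Longrightarrow> i \<noteq> j \<Longrightarrow> no_common_hyperbolic (\<Lambda> i) (\<Lambda> j)"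
  shows "convex_generator (\<Sum>i\<in>S. \<Lambda> i)"
  using assms
proof (induction S rule: finite_induct)
  case empty
  then show ?case by (simp add: convex_generator_empty)
next
  case (insert i S)
  have "no_common_hyperbolic (\<Lambda> i) (\<Sum>j\<in>S. \<Lambda> j)"
    unfolding no_common_hyperbolic_def
  proof clarify
    fix a b assume ab: "Hyp a b \<in># \<Lambda> i" "Hyp a b \<in># (\<Sum>j\<in>S. \<Lambda> j)"
    then obtain j where j: "j \<in> S" "Hyp a b \<in># \<Lambda> j"
      using insert.hyps(1) by (auto simp: set_mset_sum)
    then have "no_common_hyperbolic (\<Lambda> i) (\<Lambda> j)"
      using insert.hyps(2) by (intro insert.prems(2)) auto
    with ab j show False by (auto simp: no_common_hyperbolic_def)
  qed
  moreover have "convex_generator (\<Lambda> i)" by (rule insert.prems(1)) simp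
  moreover have "convex_generator (\<Sum>j\<in>S. \<Lambda> j)"
    by (rule insert.IH; rule insert.prems) auto
  ultimately show ?case using insert.hyps by (simp add: convex_generator_add)
qed

text \<open>
  \<open>P\<close> is a convex integral path with endpoints \<open>(0, Y)\<close> and \<open>(X, 0)\<close>. The function \<open>f\<close> is affine between
  suitable elements of the finite set \<open>V\<close>, so every change of slope occurs at an element of \<open>V\<close>.
  For concave \<open>f\<close>, being nonincreasing is the condition \<open>f'(0) \<le> 0\<close>, and makes sense for \<open>X = 0\<close>.
\<close>

definition convex_integral_path :: "nat \<Rightarrow> nat \<Rightarrow> (real \<times> real) set \<Rightarrow> bool" where
  "convex_integral_path X Y P \<longleftrightarrow> (\<exists>f V.
     concave_on {0..real X} f \<and> antimono_on {0..real X} f \<and> f ` {0..real X} \<subseteq> {0..real Y} \<and>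
     f 0 = real Y \<and>
     finite V \<and> V \<subseteq> {0..real X} \<and> (\<forall>v\<in>V. v \<in> \<int> \<and> f v \<in> \<int>) \<and>
     (\<forall>x\<in>{0..real X}. \<exists>u\<in>V. \<exists>v\<in>V. u \<le> x \<and> x \<le> v \<and> (\<exists>p q. \<forall>t\<in>{u..v}. f t = p * t + q)) \<and>
     P = {(x, f x) |x. x \<in> {0..real X}} \<union> {real X} \<times> {0..f (real X)})"

lemma convex_integral_path_path_of:
  assumes gen: "convex_generator \<Lambda>"
  shows "convex_integral_path (path_x \<Lambda>) (path_y \<Lambda>) (path_of \<Lambda>)"
proof -
  note split_paired_All [simp del] and split_paired_Ex [simp del]
  define D where "D = edge_dirs \<Lambda>"
  define m where "m c = real (edge_mult \<Lambda> c)" for c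
  define a where "a c = real (fst c)" for c :: "nat \<times> nat"
  define b where "b c = real (snd c)" for c :: "nat \<times> nat"
  define k where "k c = b c / (a c + b c)" for c
  define X where "X = (\<Sum>c\<in>D. m c * a c)"
  define Y where "Y = (\<Sum>c\<in>D. m c * b c)"
  define lt where "lt d = {c \<in> D. k c < k d}" for d
  define le where "le d = {c \<in> D. k c \<le> k d}" for d
  define sx where "sx d = (\<Sum>c\<in>lt d. m c * a c)" for d
  define sy where "sy d = Y - (\<Sum>c\<in>lt d. m c * b c)" for d
  define line where "line d x = sy d - b d / a d * (x - sx d)" for d x
  define NV where "NV = {d \<in> D. a d > 0}"
  define f where "f x = Min (insert Y ((\<lambda>d. line d x) ` NV))" for x
  define mv where "mv = m (0, 1)"

  have "D \<subseteq> (\<lambda>t. case t of Ell a b \<Rightarrow> (a, b) | Hyp a b \<Rightarrow> (a, b)) ` set_mset \<Lambda>"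
    unfolding D_def edge_dirs_def by force
  then have finD: "finite D" by (rule finite_subset) simp
  have fin [simp]: "finite (lt d)" "finite (le d)" "finite NV" for d
    using finD by (auto simp: lt_def le_def NV_def)
  have cop: "coprime (fst d) (snd d)" if "d \<in> D" for d
    using that gen by (auto simp: D_def edge_dirs_def convex_generator_def)
  have ab_pos: "a d + b d > 0" if "d \<in> D" for d
  proof -
    have "fst d + snd d > 0" using cop[OF that] by (cases "fst d") auto
    then show ?thesis unfolding a_def b_def by linarith
  qed
  have ab0: "a d \<ge> 0" "b d \<ge> 0" "m d \<ge> 0" for d by (auto simp: a_def b_def m_def)
  have m_pos: "m d > 0" if "d \<in> D" for d
    using that by (auto simp: D_def edge_dirs_def m_def edge_mult_def simp flip: not_in_iff)
  have k1: "k d \<le> 1" if "d \<in> D" for d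
    using ab_pos[OF that] ab0[of d] by (simp add: k_def field_simps)
  have k_less: "k c < k d \<longleftrightarrow> b c * a d < b d * a c" if "c \<in> D" "d \<in> D" for c d
    using ab_pos[OF that(1)] ab_pos[OF that(2)] by (simp add: k_def field_simps)
  have flatter: "flatter c d \<longleftrightarrow> k c < k d" if "c \<in> D" "d \<in> D" for c d
    unfolding k_less[OF that] flatter_def a_def b_def case_prod_beta
    by (metis of_nat_less_iff of_nat_mult)
  have k_inj: "c = d" if "c \<in> D" "d \<in> D" "k c = k d" for c d
  proof -
    have "b c * a d = b d * a c"
      using k_less[OF that(1,2)] k_less[OF that(2,1)] that(3) by linarith
    then have "snd c * fst d = snd d * fst c"
      unfolding a_def b_def by (metis of_nat_eq_iff of_nat_mult)
    then have "fst c * snd d = fst d * snd c" by (simp add: mult.commute)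
    then have "fst c = fst d \<and> snd d = snd c"
      using coprime_crossproduct_nat[OF cop[OF that(1)] cop[OF that(2)]] by simp
    then show ?thesis by (simp add: prod_eq_iff)
  qed
  have vert: "d = (0, 1)" if "d \<in> D" "a d = 0" for d
    using cop[OF that(1)] that(2) by (cases d) (auto simp: a_def)
  have le_eq: "le d = insert d (lt d)" "d \<notin> lt d" if "d \<in> D" for d
    using k_inj[OF _ that] that unfolding le_def lt_def by (auto simp: less_le)
  have sum_le: "(\<Sum>c\<in>le d. m c * g c) = (\<Sum>c\<in>lt d. m c * g c) + m d * g d" if "d \<in> D" for d g
    using le_eq[OF that] by simp
  have start: "edge_start \<Lambda> d = (sx d, sy d)" if "d \<in> D" for d
  proof -
    have 1: "{c \<in> D. flatter c d} = lt d" "{c \<in> D. \<not> flatter c d} = D - lt d"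
      using flatter[OF _ that] by (auto simp: lt_def)
    have "(\<Sum>c\<in>D - lt d. m c * b c) = Y - (\<Sum>c\<in>lt d. m c * b c)"
      unfolding Y_def using finD by (intro sum_diff) (auto simp: lt_def)
    with 1 show ?thesis
      by (simp add: edge_start_def flip: D_def)
        (simp add: sx_def sy_def m_def a_def b_def)
  qed
  have vec: "edge_vec \<Lambda> d = (m d * a d, - (m d * b d))" for d
    by (simp add: edge_vec_def m_def a_def b_def)
  have XY: "real (path_x \<Lambda>) = X" "real (path_y \<Lambda>) = Y"
    by (simp_all add: path_x_def path_y_def X_def Y_def m_def a_def b_def D_def)
  have ex_le: "sx d + m d * a d \<le> X" if "d \<in> D" for d
    unfolding sx_def sum_le[OF that, symmetric] X_def
    by (rule sum_mono2) (use finD ab0 in \<open>auto simp: le_def\<close>)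
  have ey_ge: "sy d - m d * b d \<ge> 0" if "d \<in> D" for d
  proof -
    have "(\<Sum>c\<in>le d. m c * b c) \<le> Y"
      unfolding Y_def by (rule sum_mono2) (use finD ab0 in \<open>auto simp: le_def\<close>)
    then show ?thesis using sum_le[OF that, of b] by (simp add: sy_def)
  qed
  have sx0: "sx d \<ge> 0" and syY: "sy d \<le> Y" for d
    by (auto simp: sx_def sy_def ab0 intro!: sum_nonneg)
  have X0: "X \<ge> 0" "Y \<ge> 0" by (auto simp: X_def Y_def ab0 intro!: sum_nonneg)
  have line_antimono: "line d y \<le> line d x" if "x \<le> y" for d x y
  proof -
    have "b d / a d * (x - sx d) \<le> b d / a d * (y - sx d)"
      using that ab0 by (intro mult_left_mono) auto
    then show ?thesis by (simp add: line_def)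
  qed

  have f_line: "f x = line d x" if d: "d \<in> NV" and x: "sx d \<le> x" "x \<le> sx d + m d * a d" for d x
  proof -
    have dD: "d \<in> D" "a d > 0" using d by (auto simp: NV_def)
    have "line d x \<le> Y"
      using line_antimono[OF x(1), of d] syY[of d] by (simp add: line_def)
    moreover have "line d x \<le> line e x" if e: "e \<in> NV" for e
    proof -
      have eD: "e \<in> D" "a e > 0" using e by (auto simp: NV_def)
      define t where "t = (x - sx d) / a d"
      have t: "0 \<le> t" "t \<le> m d" "x = sx d + t * a d"
        using x dD by (auto simp: t_def field_simps)
      define \<phi> where "\<phi> c = b e * a c - a e * b c" for c
      define w where "w c = (if c \<in> lt d then m c else if c = d then t else 0)" for c
      have \<phi>_pos: "\<phi> c > 0 \<longleftrightarrow> c \<in> lt e" if "c \<in> D" for c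
        using k_less[OF that eD(1)] that by (auto simp: \<phi>_def lt_def algebra_simps)
      have split: "(\<Sum>c\<in>D. w c * g c) = (\<Sum>c\<in>lt d. m c * g c) + t * g d" for g
      proof -
        have "(\<Sum>c\<in>D. w c * g c) = (\<Sum>c\<in>insert d (lt d). w c * g c)"
          using finD dD by (intro sum.mono_neutral_right) (auto simp: w_def lt_def)
        also have "\<dots> = t * g d + (\<Sum>c\<in>lt d. w c * g c)"
          using le_eq[OF dD(1)] by (simp add: w_def)
        also have "(\<Sum>c\<in>lt d. w c * g c) = (\<Sum>c\<in>lt d. m c * g c)"
          by (intro sum.cong) (auto simp: w_def)
        finally show ?thesis by simp
      qed
      have "(\<Sum>c\<in>D. w c * \<phi> c) \<le> (\<Sum>c\<in>D. if c \<in> lt e then m c * \<phi> c else 0)"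
      proof (rule sum_mono)
        fix c assume c: "c \<in> D"
        have w: "0 \<le> w c" "w c \<le> m c" using t ab0 by (auto simp: w_def)
        show "w c * \<phi> c \<le> (if c \<in> lt e then m c * \<phi> c else 0)"
        proof (cases "c \<in> lt e")
          case True
          then show ?thesis using w \<phi>_pos[OF c] by (simp add: mult_right_mono)
        next
          case False
          then have "\<phi> c \<le> 0" using \<phi>_pos[OF c] by simp
          then show ?thesis using w False by (simp add: mult_nonneg_nonpos)
        qed
      qed
      also have "\<dots> = (\<Sum>c\<in>lt e. m c * \<phi> c)"
        using finD by (subst sum.inter_restrict[symmetric]) (auto simp: lt_def intro!: sum.cong)
      finally have "(\<Sum>c\<in>lt d. m c * \<phi> c) + t * \<phi> d \<le> (\<Sum>c\<in>lt e. m c * \<phi> c)"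
        unfolding split .
      moreover have "(\<Sum>c\<in>lt g. m c * \<phi> c) = b e * sx g - a e * (Y - sy g)" for g
        by (simp add: \<phi>_def sx_def sy_def sum_distrib_left sum_subtractf algebra_simps)
      ultimately have
        "b e * sx d - a e * (Y - sy d) + t * \<phi> d \<le> b e * sx e - a e * (Y - sy e)"
        by simp
      then have "a e * (sy d - t * b d) \<le> a e * sy e - b e * (x - sx e)"
        by (simp add: \<phi>_def t(3) algebra_simps)
      then have "sy d - t * b d \<le> sy e - b e / a e * (x - sx e)"
        using eD by (simp add: field_simps)
      moreover have "line d x = sy d - t * b d"
        using dD by (simp add: line_def t_def)
      ultimately show ?thesis by (simp add: line_def)
    qed
    ultimately show ?thesis
      unfolding f_def using d by (intro Min_eqI) auto
  qed
  have f_le: "f x \<le> line d x" if "d \<in> NV" for d x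
    unfolding f_def using that by (intro Min_le) auto
  have f_leY: "f x \<le> Y" for x
    unfolding f_def by (intro Min_le) auto

  have next_edge: "\<exists>e\<in>NV. sx e = sx d + m d * a d"
    if d: "d \<in> D" "sx d + m d * a d < X" for d
  proof -
    define E where "E = {c \<in> NV. k d < k c}"
    have "E \<noteq> {}"
    proof
      assume E: "E = {}"
      have "(\<Sum>c\<in>D. m c * a c) = (\<Sum>c\<in>le d. m c * a c)"
      proof (intro sum.mono_neutral_right ballI)
        fix c assume c: "c \<in> D - le d"
        then have "c \<notin> NV" using E by (cases c) (auto simp: E_def le_def not_le)
        then show "m c * a c = 0" using c ab0(1)[of c] by (auto simp: NV_def)
      qed (use finD in \<open>auto simp: le_def\<close>)
      with d sum_le[OF d(1), of a] show False by (simp add: X_def sx_def)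
    qed
    moreover have "finite E" by (auto simp: E_def)
    ultimately obtain e where e: "e \<in> E" "\<And>c. c \<in> E \<Longrightarrow> k e \<le> k c"
      using arg_min_if_finite[of E k] by (meson leI)
    have "(\<Sum>c\<in>lt e. m c * a c) = (\<Sum>c\<in>le d. m c * a c)"
    proof (intro sum.mono_neutral_right ballI)
      show "le d \<subseteq> lt e" using e(1) by (auto simp: le_def lt_def E_def)
      fix c assume c: "c \<in> lt e - le d"
      then have "c \<notin> E" using e(2)[of c] by (auto simp: lt_def)
      then show "m c * a c = 0" using c ab0(1)[of c] by (auto simp: E_def NV_def le_def lt_def)
    qed simp
    then show ?thesis using e(1) sum_le[OF d(1), of a] by (auto simp: sx_def E_def)
  qed

  have cover: "\<exists>d\<in>NV. sx d \<le> x \<and> x \<le> sx d + m d * a d" if x: "0 \<le> x" "x \<le> X" "X > 0" for x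
  proof -
    have "NV \<noteq> {}"
    proof
      assume "NV = {}"
      then have "a c = 0" if "c \<in> D" for c using ab0(1)[of c] that by (auto simp: NV_def)
      then have "X = 0" by (simp add: X_def)
      with x show False by simp
    qed
    then obtain d0 where d0: "d0 \<in> NV" "\<And>c. c \<in> NV \<Longrightarrow> k d0 \<le> k c"
      using arg_min_if_finite[of NV k] fin(3) by (meson leI)
    have "sx d0 = 0"
      unfolding sx_def
    proof (intro sum.neutral ballI)
      fix c assume c: "c \<in> lt d0"
      then have "c \<notin> NV" using d0(2)[of c] by (auto simp: lt_def)
      then show "m c * a c = 0" using c ab0(1)[of c] by (auto simp: NV_def lt_def)
    qed
    define T where "T = sx ` {d \<in> NV. sx d \<le> x}"
    have T: "finite T" "T \<noteq> {}" using d0 \<open>sx d0 = 0\<close> x by (auto simp: T_def)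
    obtain d where d: "d \<in> NV" "sx d \<le> x" "sx d = Max T"
      using Max_in[OF T] by (auto simp: T_def)
    have "x \<le> sx d + m d * a d"
    proof (rule ccontr)
      assume "\<not> ?thesis"
      then have lt: "sx d + m d * a d < x" by simp
      have dD: "d \<in> D" "a d > 0" using d by (auto simp: NV_def)
      obtain e where e: "e \<in> NV" "sx e = sx d + m d * a d"
        using next_edge[OF dD(1)] lt x by force
      then have "sx e \<in> T" unfolding T_def using lt by (intro imageI) simp
      then have "sx e \<le> Max T" using T by simp
      moreover have "m d * a d > 0" using m_pos[OF dD(1)] dD(2) by simp
      ultimately show False using e d(3) by simp
    qed
    with d show ?thesis by blast
  qed

  have f_X0: "f x = Y" if "X = 0" for x
  proof -
    have "NV = {}"
    proof (rule ccontr)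
      assume "NV \<noteq> {}"
      then obtain d where "d \<in> D" "a d > 0" by (auto simp: NV_def)
      with ex_le[of d] m_pos[of d] sx0[of d] that show False
        by (smt (verit) mult_pos_pos)
    qed
    then show ?thesis by (simp add: f_def)
  qed
  have f0: "f 0 = Y"
  proof (cases "X > 0")
    case True
    then obtain d where d: "d \<in> NV" "sx d \<le> 0" "0 \<le> sx d + m d * a d"
      using cover[of 0] X0 by auto
    then have "f 0 = line d 0" by (intro f_line) auto
    moreover have s0: "sx d = 0" using d sx0[of d] by simp
    moreover have "sy d = Y"
    proof -
      have "lt d = {}"
      proof (rule ccontr)
        assume "lt d \<noteq> {}"
        then obtain c where c: "c \<in> D" "k c < k d" by (auto simp: lt_def)
        have "m c * a c = 0"
          using s0 ab0 c finD unfolding sx_def by (subst (asm) sum_nonneg_eq_0_iff) (auto simp: lt_def)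
        then have "a c = 0" using m_pos[OF c(1)] by simp
        then have "k c = 1" using ab_pos[OF c(1)] by (simp add: k_def)
        with c(2) k1[of d] d(1) show False by (simp add: NV_def)
      qed
      then show ?thesis by (simp add: sy_def)
    qed
    ultimately show ?thesis by (simp add: line_def)
  next
    case False
    with X0 f_X0 show ?thesis by simp
  qed
  have mv0: "mv \<ge> 0" by (simp add: mv_def ab0)
  have vert_le: "(\<Sum>c\<in>D'. m c * b c) \<le> mv"
    if "D' \<subseteq> D" "\<And>c. c \<in> D' \<Longrightarrow> a c = 0" for D'
  proof -
    have "D' \<subseteq> {(0, 1)}" using that vert by blast
    then have "(\<Sum>c\<in>D'. m c * b c) \<le> (\<Sum>c\<in>{(0,1)}. m c * b c)"
      by (intro sum_mono2) (auto simp: ab0)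
    then show ?thesis by (simp add: mv_def b_def)
  qed
  have fX: "f X \<le> mv"
  proof (cases "X > 0")
    case True
    then obtain d where d: "d \<in> NV" "sx d \<le> X" "X \<le> sx d + m d * a d"
      using cover[of X] by auto
    have dD: "d \<in> D" "a d > 0" using d by (auto simp: NV_def)
    have X: "X = sx d + m d * a d" using ex_le[OF dD(1)] d by simp
    have "f X = line d X" using d by (intro f_line) auto
    also have "\<dots> = sy d - m d * b d" using dD by (simp add: line_def X)
    also have "\<dots> = (\<Sum>c\<in>D - le d. m c * b c)"
      using finD sum_le[OF dD(1), of b]
      by (subst sum_diff) (auto simp: le_def sy_def Y_def)
    also have "\<dots> \<le> mv"
    proof (rule vert_le)
      have "(\<Sum>c\<in>D - le d. m c * a c) = 0"
        using finD sum_le[OF dD(1), of a] X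
        by (subst sum_diff) (auto simp: le_def sx_def X_def)
      then have "m c * a c = 0" if "c \<in> D - le d" for c
        using that finD ab0 by (subst (asm) sum_nonneg_eq_0_iff) auto
      then show "a c = 0" if "c \<in> D - le d" for c using that m_pos[of c] by fastforce
    qed auto
    finally show ?thesis .
  next
    case False
    then have "X = 0" using X0 by simp
    then have "m c * a c = 0" if "c \<in> D" for c
      using that finD ab0 unfolding X_def by (subst (asm) sum_nonneg_eq_0_iff) auto
    then have "a c = 0" if "c \<in> D" for c using that m_pos[of c] by fastforce
    then have "Y \<le> mv" unfolding Y_def by (intro vert_le) auto
    then show ?thesis using f_X0[OF \<open>X = 0\<close>] by simp
  qed
  have f_nonneg: "f x \<ge> 0" if xX: "0 \<le> x" "x \<le> X" for x
  proof (cases "X > 0")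
    case True
    then obtain d where d: "d \<in> NV" "sx d \<le> x" "x \<le> sx d + m d * a d"
      using cover[of x] xX by auto
    have dD: "d \<in> D" "a d > 0" using d by (auto simp: NV_def)
    have "0 \<le> sy d - m d * b d" by (rule ey_ge[OF dD(1)])
    also have "\<dots> = line d (sx d + m d * a d)" using dD by (simp add: line_def)
    also have "\<dots> \<le> line d x" by (rule line_antimono[OF d(3)])
    finally show ?thesis using f_line[OF d] by simp
  next
    case False
    then show ?thesis using X0 f_X0 by simp
  qed
  have supp: "\<exists>p q. p \<le> 0 \<and> f x = p * x + q \<and> (\<forall>y. f y \<le> p * y + q)"
    if xX: "0 \<le> x" "x \<le> X" for x
  proof (cases "X > 0")
    case True
    then obtain d where d: "d \<in> NV" "sx d \<le> x" "x \<le> sx d + m d * a d"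
      using cover[of x] xX by auto
    have "line d y = - (b d / a d) * y + (sy d + b d / a d * sx d)" for y
      by (simp add: line_def algebra_simps diff_divide_distrib)
    moreover have "- (b d / a d) \<le> 0" using ab0 by simp
    ultimately show ?thesis using f_line[OF d] f_le[OF d(1)] by metis
  next
    case False
    then have "f y = 0 * y + Y" for y using X0 f_X0 by simp
    then show ?thesis by (metis order_refl)
  qed

  define V where "V = insert 0 (sx ` NV \<union> (\<lambda>d. sx d + m d * a d) ` NV)"
  have int_m: "m c * a c \<in> \<int>" "m c * b c \<in> \<int>" for c by (auto simp: m_def a_def b_def)
  have int_sx: "sx d \<in> \<int>" for d unfolding sx_def by (intro Ints_sum int_m)
  have int_Y: "Y \<in> \<int>" unfolding Y_def by (intro Ints_sum int_m)
  have int_sy: "sy d \<in> \<int>" for d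
    unfolding sy_def by (intro Ints_diff Ints_sum int_m int_Y)

  have P: "path_of \<Lambda> = {(x, f x) |x. x \<in> {0..X}} \<union> {X} \<times> {0..f X}" (is "_ = ?R")
  proof (intro equalityI subsetI)
    fix p assume p: "p \<in> path_of \<Lambda>"
    show "p \<in> ?R"
    proof (cases "p = (0, Y)")
      case True
      then show ?thesis using f0 X0 by auto
    next
      case False
      then obtain d where d: "d \<in> D" "p \<in> closed_segment (sx d, sy d) ((sx d, sy d) + edge_vec \<Lambda> d)"
        using p start by (auto simp: path_of_def XY D_def)
      then obtain u where u: "0 \<le> u" "u \<le> 1" "p = (sx d, sy d) + u *\<^sub>R edge_vec \<Lambda> d"
        by (auto simp: closed_segment_def algebra_simps)
      then have pe: "p = (sx d + u * m d * a d, sy d - u * m d * b d)"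
        by (simp add: vec)
      have um: "0 \<le> u * (m d * z)" "u * (m d * z) \<le> m d * z" if "z \<ge> 0" for z
        using u ab0[of d] that by (auto intro!: mult_left_le_one_le)
      show ?thesis
      proof (cases "a d > 0")
        case True
        then have dN: "d \<in> NV" using d by (simp add: NV_def)
        let ?x = "sx d + u * m d * a d"
        have x: "sx d \<le> ?x" "?x \<le> sx d + m d * a d"
          using um[OF ab0(1)[of d]] by (auto simp: mult.assoc)
        have "f ?x = sy d - u * m d * b d"
          using f_line[OF dN x] True by (simp add: line_def)
        then have "p = (?x, f ?x)" by (simp add: pe)
        moreover have "?x \<in> {0..X}" using x sx0[of d] ex_le[OF d(1)] by simp
        ultimately show ?thesis by blast
      next
        case False
        then have a0: "a d = 0" using ab0(1)[of d] by simp
        then have kd: "k d = 1" using ab_pos[OF d(1)] by (simp add: k_def)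
        have lt: "lt d = D - {d}"
          using k1 k_inj[OF _ d(1)] kd by (force simp: lt_def)
        have sxX: "sx d = X"
          unfolding sx_def X_def lt using a0 finD d(1) by (simp add: sum.remove)
        have syM: "sy d = m d * b d"
          unfolding sy_def Y_def lt using finD d(1) by (simp add: sum.remove)
        have ge: "m d * b d \<le> f X"
        proof (cases "X > 0")
          case True
          then obtain e where e: "e \<in> NV" "sx e \<le> X" "X \<le> sx e + m e * a e"
            using cover[of X] by auto
          have eD: "e \<in> D" "a e > 0" using e by (auto simp: NV_def)
          have X: "X = sx e + m e * a e" using ex_le[OF eD(1)] e by simp
          have "e \<noteq> d" using eD a0 by auto
          have "m d * b d = (\<Sum>c\<in>{d}. m c * b c)" by simp
          also have "\<dots> \<le> (\<Sum>c\<in>D - le e. m c * b c)"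
          proof (rule sum_mono2)
            have "e \<in> lt d" using eD \<open>e \<noteq> d\<close> by (simp add: lt)
            then show "{d} \<subseteq> D - le e" using d(1) by (auto simp: le_def lt_def)
          qed (use finD ab0 in auto)
          also have "\<dots> = sy e - m e * b e"
            using finD sum_le[OF eD(1), of b]
            by (subst sum_diff) (auto simp: le_def sy_def Y_def)
          also have "\<dots> = f X"
            using f_line[OF e] eD by (simp add: line_def X)
          finally show ?thesis .
        next
          case False
          then have "f X = Y" using X0 f_X0 by simp
          then show ?thesis using syM syY[of d] by simp
        qed
        have "p \<in> {X} \<times> {0..f X}"
          using ge um[OF ab0(2)[of d]] by (simp add: pe a0 sxX syM mult.assoc)
        then show ?thesis by blast
      qed
    qed
  next
    fix p assume "p \<in> ?R"
    then consider (graph) x where "p = (x, f x)" "0 \<le> x" "x \<le> X"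
      | (vertical) y where "p = (X, y)" "0 \<le> y" "y \<le> f X" by auto
    then have "(\<exists>x. p = (x, f x) \<and> 0 \<le> x \<and> x \<le> X) \<or> 
      (\<exists>y. p = (X, y) \<and> 0 \<le> y \<and> y \<le> mv \<and> (0,1) \<in> D)"
    proof cases
      case vertical
      show ?thesis
      proof (cases "(0, 1) \<in> D")
        case True
        then show ?thesis using vertical fX by auto
      next
        case False
        then have "mv = 0"
          by (auto simp: mv_def m_def D_def edge_dirs_def edge_mult_def not_in_iff)
        then have "y = f X" using vertical fX by simp
        then show ?thesis using vertical X0 by auto
      qed
    qed auto
    then show "p \<in> path_of \<Lambda>"
    proof (elim disjE exE conjE)
      fix x assume x: "p = (x, f x)" "0 \<le> x" "x \<le> X"
      show ?thesis
      proof (cases "X > 0")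
        case True
        then obtain d where d: "d \<in> NV" "sx d \<le> x" "x \<le> sx d + m d * a d"
          using cover[of x] x by auto
        have dD: "d \<in> D" "a d > 0" using d by (auto simp: NV_def)
        define u where "u = (x - sx d) / (m d * a d)"
        have ma: "m d * a d > 0" using dD m_pos by simp
        have u: "0 \<le> u" "u \<le> 1" using d ma by (auto simp: u_def)
        have "m d > 0" using dD m_pos by simp
        then have "p = (sx d, sy d) + u *\<^sub>R edge_vec \<Lambda> d"
          using dD f_line[OF d] by (simp add: x(1) vec u_def line_def)
        then have "p \<in> closed_segment (sx d, sy d) ((sx d, sy d) + edge_vec \<Lambda> d)"
          using u by (auto simp: closed_segment_def algebra_simps intro!: exI[of _ u])
        then show ?thesis
          using dD start by (auto simp: path_of_def D_def)
      next
        case False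
        then have "p = (0, Y)" using x X0 f_X0 by auto
        then show ?thesis by (simp add: path_of_def XY)
      qed
    next
      fix y assume y: "p = (X, y)" "0 \<le> y" "y \<le> mv" and d: "(0, 1) \<in> D"
      let ?d = "(0, 1) :: nat \<times> nat"
      have a0: "a ?d = 0" "b ?d = 1" by (auto simp: a_def b_def)
      then have kd: "k ?d = 1" by (simp add: k_def)
      have lt: "lt ?d = D - {?d}"
        using k1 k_inj[OF _ d] kd by (force simp: lt_def)
      have sxX: "sx ?d = X"
        unfolding sx_def X_def lt using a0 finD d by (simp add: sum.remove)
      have syM: "sy ?d = mv"
        unfolding sy_def Y_def lt using finD d a0 by (simp add: sum.remove mv_def)
      have mp: "mv > 0" using m_pos[OF d] by (simp add: mv_def)
      define u where "u = 1 - y / mv"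
      have u: "0 \<le> u" "u \<le> 1" using y mp by (auto simp: u_def)
      have "p = (sx ?d, sy ?d) + u *\<^sub>R edge_vec \<Lambda> ?d"
        unfolding y(1) vec u_def sxX syM a0 mv_def[symmetric] using mp by (simp add: field_simps)
      then have "p \<in> closed_segment (sx ?d, sy ?d) ((sx ?d, sy ?d) + edge_vec \<Lambda> ?d)"
        using u by (auto simp: closed_segment_def algebra_simps intro!: exI[of _ u])
      then show ?thesis
        unfolding path_of_def start[OF d, symmetric] using d[unfolded D_def] by blast
    qed
  qed

  show ?thesis
    unfolding convex_integral_path_def XY
  proof (intro exI[of _ f] exI[of _ V] conjI)
    show "concave_on {0..X} f"
      unfolding concave_on_iff
    proof (intro conjI ballI allI impI)
      fix x y u v :: real
      assume xy: "x \<in> {0..X}" "y \<in> {0..X}" and uv: "0 \<le> u" "0 \<le> v" "u + v = 1"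
      have "u *\<^sub>R x + v *\<^sub>R y \<in> {0..X}"
        using xy uv convexD[OF convex_real_interval(5)] by blast
      then obtain p q where pq: "f (u * x + v * y) = p * (u * x + v * y) + q"
        "\<And>z. f z \<le> p * z + q" using supp[of "u * x + v * y"] by auto
      have "u * f x + v * f y \<le> u * (p * x + q) + v * (p * y + q)"
        using pq(2) uv by (intro add_mono mult_left_mono) auto
      also have "\<dots> = p * (u * x + v * y) + (u + v) * q" by (simp add: algebra_simps)
      finally show "u * f x + v * f y \<le> f (u *\<^sub>R x + v *\<^sub>R y)"
        using pq(1) uv by simp
    qed simp
    show "antimono_on {0..X} f"
    proof (rule monotone_onI)
      fix x y :: real assume xy: "x \<in> {0..X}" "y \<in> {0..X}" "x \<le> y"
      then obtain p q where pq: "p \<le> 0" "f x = p * x + q" "f y \<le> p * y + q"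
        using supp[of x] by auto
      have "p * y \<le> p * x" using xy pq(1) by (simp add: mult_left_mono_neg)
      with pq show "f y \<le> f x" by simp
    qed
    show "f ` {0..X} \<subseteq> {0..Y}" using f_nonneg f_leY by auto
    show "f 0 = Y" by (rule f0)
    show "finite V" by (simp add: V_def)
    show "V \<subseteq> {0..X}"
    proof
      fix v assume "v \<in> V"
      then consider "v = 0" | d where "d \<in> NV" "v = sx d" | d where "d \<in> NV" "v = sx d + m d * a d"
        by (auto simp: V_def)
      then show "v \<in> {0..X}"
      proof cases
        case (2 d)
        have "0 \<le> m d * a d" by (simp add: ab0)
        with 2 show ?thesis using ex_le[of d] sx0[of d] by (simp add: NV_def)
      next
        case (3 d)
        have "0 \<le> m d * a d" by (simp add: ab0)
        with 3 show ?thesis using ex_le[of d] sx0[of d] by (simp add: NV_def)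
      qed (use X0 in auto)
    qed
    show "\<forall>v\<in>V. v \<in> \<int> \<and> f v \<in> \<int>"
    proof
      fix v assume "v \<in> V"
      then consider "v = 0" | d where "d \<in> NV" "v = sx d" | d where "d \<in> NV" "v = sx d + m d * a d"
        by (auto simp: V_def)
      then show "v \<in> \<int> \<and> f v \<in> \<int>"
      proof cases
        case 1
        then show ?thesis using f0 int_Y by simp
      next
        case (2 d)
        have "0 \<le> m d * a d" by (simp add: ab0)
        then have "f v = sy d" using f_line[OF 2(1), of v] 2 by (simp add: line_def)
        then show ?thesis using 2 int_sx int_sy by simp
      next
        case (3 d)
        have "0 \<le> m d * a d" by (simp add: ab0)
        then have "f v = sy d - m d * b d"
          using f_line[OF 3(1), of v] 3 by (simp add: line_def NV_def)
        then show ?thesis using 3 int_sx int_sy int_m by simp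
      qed
    qed
    show "\<forall>x\<in>{0..X}. \<exists>u\<in>V. \<exists>v\<in>V. u \<le> x \<and> x \<le> v \<and> (\<exists>p q. \<forall>t\<in>{u..v}. f t = p * t + q)"
    proof
      fix x assume x: "x \<in> {0..X}"
      show "\<exists>u\<in>V. \<exists>v\<in>V. u \<le> x \<and> x \<le> v \<and> (\<exists>p q. \<forall>t\<in>{u..v}. f t = p * t + q)"
      proof (cases "X > 0")
        case True
        then obtain d where d: "d \<in> NV" "sx d \<le> x" "x \<le> sx d + m d * a d"
          using cover[of x] x by auto
        have "\<forall>t\<in>{sx d..sx d + m d * a d}. f t = - (b d / a d) * t + (sy d + b d / a d * sx d)"
          using f_line[OF d(1)] by (auto simp: line_def algebra_simps diff_divide_distrib)
        moreover have "sx d \<in> V" "sx d + m d * a d \<in> V" using d(1) by (auto simp: V_def)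
        ultimately show ?thesis using d(2,3) by blast
      next
        case False
        then have "x = 0" using x by simp
        moreover have "\<forall>t\<in>{0..0}. f t = 0 * t + Y" using f0 by simp
        moreover have "0 \<in> V" by (simp add: V_def)
        ultimately show ?thesis by blast
      qed
    qed
    show "path_of \<Lambda> = {(x, f x) |x. x \<in> {0..X}} \<union> {X} \<times> {0..f X}" by (rule P)
  qed
qed

end

theory Submission imports Defs begin

text \<open>
  Pick's theorem gives \<open>2 (L(\<Lambda>) - 1) = 2 A + x(\<Lambda>) + y(\<Lambda>) + m\<close>, where \<open>A\<close> is the area of the region and
  \<open>m\<close> is the number of factors of \<open>\<Lambda>\<close>. Since \<open>2 A\<close> is the sum of \<open>max (a d) (b c)\<close> over all ordered
  pairs of factors with directions \<open>(a, b)\<close> and \<open>(c, d)\<close>, the index is a quadratic form plus a linear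
  form in the formal product. Such a function is determined on a product by its values on the factors
  and on the pairwise products. The lattice point formula itself follows by splitting off one
  primitive segment at the flat end of the path: the remaining path is a translate, and the columns
  below the segment are counted by pairing \<open>i\<close> with \<open>a - i\<close>.
\<close>

section \<open>Quadratic and linear forms in the factors, and the passage from edges to
  factors\<close>

primrec orbit_dir :: "orbit \<Rightarrow> nat \<times> nat" where
  "orbit_dir (Ell a b) = (a, b)"
| "orbit_dir (Hyp a b) = (a, b)"

primrec is_hyp :: "orbit \<Rightarrow> bool" where
  "is_hyp (Ell a b) = False"
| "is_hyp (Hyp a b) = True"

text \<open>Twice the mixed area of the two regions. Multiplying generators takes the Minkowski sum
  of regions, and each \<open>max\<close> is the value of this form on two triangles with legs on
  the axes.\<close>

definition mixed_area :: "formal_product \<Rightarrow> formal_product \<Rightarrow> int" where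
  "mixed_area \<Lambda> M = (\<Sum>p\<in>#\<Lambda>. \<Sum>q\<in>#M. int (max (fst (orbit_dir p) * snd (orbit_dir q))
                                            (fst (orbit_dir q) * snd (orbit_dir p))))"

text \<open>Lattice length of the closed boundary of the region: every factor is one primitive
  segment of the path, and its horizontal and vertical extents account for the two sides on the
  axes.\<close>

definition boundary_length :: "formal_product \<Rightarrow> int" where
  "boundary_length \<Lambda> = (\<Sum>p\<in>#\<Lambda>. int (fst (orbit_dir p) + snd (orbit_dir p) + 1))"

lemma edge_dirs_eq: "edge_dirs \<Lambda> = orbit_dir ` set_mset \<Lambda>"
proof -
  have "c \<in> edge_dirs \<Lambda> \<longleftrightarrow> (\<exists>p\<in>set_mset \<Lambda>. c = orbit_dir p)" for c
  proof (cases c)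
    case (Pair a b)
    have "c = orbit_dir p \<longleftrightarrow> p = Ell a b \<or> p = Hyp a b" for p
      using Pair by (cases p) auto
    then show ?thesis using Pair by (auto simp: edge_dirs_def)
  qed
  then show ?thesis by auto
qed

lemma finite_edge_dirs: "finite (edge_dirs \<Lambda>)"
  by (simp add: edge_dirs_eq)

lemma edge_mult_add_mset:
  "edge_mult (add_mset p \<Lambda>) c = edge_mult \<Lambda> c + (if c = orbit_dir p then 1 else 0)"
  by (cases p; cases c) (auto simp: edge_mult_def)

lemma edge_mult_eq_0: "c \<notin> edge_dirs \<Lambda> \<Longrightarrow> edge_mult \<Lambda> c = 0"
  by (cases c) (auto simp: edge_mult_def edge_dirs_def not_in_iff)

text \<open>An edge collects all factors of one direction. Rewriting sums over edges as sums over
  factors makes the effect of adding a single factor visible.\<close>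

lemma sum_edge_dirs:
  "(\<Sum>c | c \<in> edge_dirs \<Lambda> \<and> P c. edge_mult \<Lambda> c * g c)
     = (\<Sum>p\<in>#\<Lambda>. if P (orbit_dir p) then g (orbit_dir p) else 0)"
proof -
  \<comment> \<open>The index set is a fixed finite superset \<open>A\<close>, because
    \<open>edge_dirs\<close> itself changes along the induction on the multiset.\<close>
  have *: "(\<Sum>c\<in>A. edge_mult \<Lambda> c * (if P c then g c else 0))
      = (\<Sum>p\<in>#\<Lambda>. if P (orbit_dir p) then g (orbit_dir p) else 0)"
    if "finite A" "edge_dirs \<Lambda> \<subseteq> A" for A
    using that(2)
  proof (induction \<Lambda>)
    case empty
    show ?case by (simp add: edge_mult_def case_prod_beta)
  next
    case (add p \<Lambda>)
    have "(\<Sum>c\<in>A. edge_mult (add_mset p \<Lambda>) c * (if P c then g c else 0))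
        = (\<Sum>c\<in>A. edge_mult \<Lambda> c * (if P c then g c else 0))
          + (\<Sum>c\<in>A. if c = orbit_dir p then (if P c then g c else 0) else 0)"
      unfolding sum.distrib[symmetric]
      by (rule sum.cong) (auto simp: edge_mult_add_mset)
    also have "\<dots> = (\<Sum>c\<in>A. edge_mult \<Lambda> c * (if P c then g c else 0))
          + (if P (orbit_dir p) then g (orbit_dir p) else 0)"
      using add.prems \<open>finite A\<close> by (simp add: edge_dirs_eq)
    finally show ?case using add by (simp add: edge_dirs_eq)
  qed
  have "(\<Sum>c | c \<in> edge_dirs \<Lambda> \<and> P c. edge_mult \<Lambda> c * g c)
      = (\<Sum>c\<in>edge_dirs \<Lambda>. edge_mult \<Lambda> c * (if P c then g c else 0))"
    by (rule sum.mono_neutral_cong_left) (auto simp: finite_edge_dirs)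
  with *[OF finite_edge_dirs order_refl] show ?thesis by simp
qed

lemma path_y_eq: "path_y \<Lambda> = (\<Sum>p\<in>#\<Lambda>. snd (orbit_dir p))"
  using sum_edge_dirs[where P = "\<lambda>_. True" and g = snd and \<Lambda> = \<Lambda>] by (simp add: path_y_def)

lemma edge_start_eq:
  "edge_start \<Lambda> d =
     (real (\<Sum>p\<in>#\<Lambda>. if flatter (orbit_dir p) d then fst (orbit_dir p) else 0),
      real (\<Sum>p\<in>#\<Lambda>. if \<not> flatter (orbit_dir p) d then snd (orbit_dir p) else 0))"
  unfolding edge_start_def sum_edge_dirs ..

section \<open>Splitting off the primitive segment at the flat end\<close>

definition edge_segment :: "formal_product \<Rightarrow> nat \<times> nat \<Rightarrow> (real \<times> real) set" where
  "edge_segment \<Lambda> d = closed_segment (edge_start \<Lambda> d) (edge_start \<Lambda> d + edge_vec \<Lambda> d)"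

text \<open>No factor precedes \<open>d\<close>, and all of them still lie between it and the
  horizontal axis. The direction \<open>d\<close> may be absent from the product, as happens when
  its last factor has been removed.\<close>

lemma edge_start_flattest:
  assumes "\<forall>q\<in>#\<Lambda>. \<not> flatter (orbit_dir q) d"
  shows "edge_start \<Lambda> d = (0, real (path_y \<Lambda>))"
proof -
  have "(\<Sum>p\<in>#\<Lambda>. if flatter (orbit_dir p) d then fst (orbit_dir p) else 0) = (\<Sum>p\<in>#\<Lambda>. 0)"
    "(\<Sum>p\<in>#\<Lambda>. if \<not> flatter (orbit_dir p) d then snd (orbit_dir p) else 0) = path_y \<Lambda>"
    unfolding path_y_eq using assms by (auto intro!: arg_cong[where f = sum_mset] image_mset_cong)
  then show ?thesis by (simp only: edge_start_eq) simp
qed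

text \<open>The inserted initial point is absorbed by the segment of \<open>d\<close>, which
  degenerates to exactly this point if \<open>d\<close> is not an edge direction. The empty product
  thus needs no separate treatment.\<close>

lemma path_of_flattest:
  assumes "\<forall>q\<in>#\<Lambda>. \<not> flatter (orbit_dir q) d"
  shows "path_of \<Lambda> = edge_segment \<Lambda> d \<union> (\<Union>c\<in>edge_dirs \<Lambda> - {d}. edge_segment \<Lambda> c)"
proof -
  have "(0, real (path_y \<Lambda>)) \<in> edge_segment \<Lambda> d"
    by (simp add: edge_segment_def edge_start_flattest[OF assms])
  moreover have "edge_segment \<Lambda> d = {(0, real (path_y \<Lambda>))}" if "d \<notin> edge_dirs \<Lambda>"
    using edge_mult_eq_0[OF that]
    by (simp add: edge_segment_def edge_start_flattest[OF assms] edge_vec_def flip: zero_prod_def)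
  ultimately show ?thesis
    unfolding path_of_def edge_segment_def[symmetric] by (cases "d \<in> edge_dirs \<Lambda>") auto
qed

text \<open>Two directions of which neither is flatter are parallel, and parallel primitive vectors
  coincide.\<close>

lemma flatter_or_eq:
  assumes "coprime (fst c) (snd c)" "coprime (fst d) (snd d)" "\<not> flatter c d"
  shows "flatter d c \<or> d = c"
proof -
  have "d = c" if "\<not> flatter d c"
  proof -
    from that assms(3) have "snd c * fst d = snd d * fst c"
      by (auto simp: flatter_def case_prod_beta)
    then have "fst c * snd d = fst d * snd c" by (simp add: mult.commute)
    then show ?thesis
      using coprime_crossproduct_nat[OF assms(1,2)] by (auto simp: prod_eq_iff)
  qed
  then show ?thesis by blast
qed

text \<open>The new factor is traversed first, so the old path follows it, moved right by
  \<open>a\<close>. If the direction of \<open>p\<close> already occurs, its longer edge is cut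
  after one primitive vector.\<close>

lemma path_of_add_flattest:
  assumes cop: "\<forall>q\<in>#add_mset p \<Lambda>. coprime (fst (orbit_dir q)) (snd (orbit_dir q))"
    and flat: "\<forall>q\<in>#\<Lambda>. \<not> flatter (orbit_dir q) (orbit_dir p)"
    and p: "orbit_dir p = (a, b)"
  shows "path_of (add_mset p \<Lambda>) =
    closed_segment (0, real (path_y \<Lambda> + b)) (real a, real (path_y \<Lambda>)) \<union> (+) (real a, 0) ` path_of \<Lambda>"
proof -
  define N where "N = add_mset p \<Lambda>"
  define Y where "Y = path_y \<Lambda>"
  define v :: "real \<times> real" where "v = (real a, - real b)"
  define s :: "real \<times> real" where "s = (0, real (Y + b))"
  let ?d = "(a, b)" and ?m = "edge_mult \<Lambda> (a, b)"
  have flatN: "\<forall>q\<in>#N. \<not> flatter (orbit_dir q) ?d"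
    using flat p by (auto simp: N_def flatter_def)
  have yN: "path_y N = Y + b" by (simp add: N_def Y_def path_y_eq p)
  have dirs: "edge_dirs N - {?d} = edge_dirs \<Lambda> - {?d}" by (auto simp: N_def edge_dirs_eq p)
  \<comment> \<open>The new factor is strictly flatter than every other direction \<open>c\<close>:
    it adds \<open>a\<close> to the abscissa where \<open>c\<close> starts and nothing to the
    height.\<close>
  have trans: "edge_segment N c = (+) (real a, 0) ` edge_segment \<Lambda> c" if c: "c \<in> edge_dirs \<Lambda> - {?d}" for c
  proof -
    from c obtain q where q: "q \<in># \<Lambda>" "c = orbit_dir q" by (auto simp: edge_dirs_eq)
    have "flatter ?d c"
      using flatter_or_eq[of c ?d] cop flat q c p by force
    then have "edge_start N c = (real a, 0) + edge_start \<Lambda> c"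
      by (simp add: N_def edge_start_eq p)
    moreover have "edge_vec N c = edge_vec \<Lambda> c"
      using c by (simp add: N_def edge_vec_def edge_mult_add_mset p)
    ultimately show ?thesis
      by (simp add: edge_segment_def closed_segment_translation[symmetric] add.assoc)
  qed
  have \<Lambda>d: "edge_start \<Lambda> ?d = (0, real Y)" "edge_vec \<Lambda> ?d = real ?m *\<^sub>R v"
    using edge_start_flattest[of \<Lambda> ?d] flat p by (auto simp: Y_def edge_vec_def v_def)
  have "edge_mult N ?d = Suc ?m" by (simp add: N_def edge_mult_add_mset p)
  then have Nd: "edge_start N ?d = s" "edge_vec N ?d = real (Suc ?m) *\<^sub>R v"
    using edge_start_flattest[OF flatN] by (simp_all add: s_def yN edge_vec_def v_def algebra_simps)
  have sv: "s + v = (real a, real Y)" by (simp add: s_def v_def)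
  have "s + u *\<^sub>R w \<in> closed_segment s (s + w)" if "0 \<le> u" "u \<le> 1" for u w
    using that by (auto simp: closed_segment_def algebra_simps intro!: exI[of _ u])
  \<comment> \<open>The cut point \<open>s + v\<close> lies at the fraction
    \<open>1 / (m + 1)\<close> of the edge, where \<open>m\<close> is the old multiplicity.\<close>
  from this[of "1 / real (Suc ?m)" "real (Suc ?m) *\<^sub>R v"]
  have "s + v \<in> closed_segment s (s + real (Suc ?m) *\<^sub>R v)" by (simp del: of_nat_Suc)
  then have "edge_segment N ?d = closed_segment s (s + v) \<union> closed_segment (s + v) (s + real (Suc ?m) *\<^sub>R v)"
    by (simp only: edge_segment_def Nd Un_closed_segment)
  also have "closed_segment (s + v) (s + real (Suc ?m) *\<^sub>R v) = (+) (real a, 0) ` edge_segment \<Lambda> ?d"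
    unfolding edge_segment_def \<Lambda>d closed_segment_translation[symmetric]
    by (simp add: s_def v_def algebra_simps)
  finally have "edge_segment N ?d = closed_segment s (s + v) \<union> (+) (real a, 0) ` edge_segment \<Lambda> ?d" .
  moreover have "path_of N = edge_segment N ?d \<union> (\<Union>c\<in>edge_dirs \<Lambda> - {?d}. (+) (real a, 0) ` edge_segment \<Lambda> c)"
    using path_of_flattest[OF flatN] trans by (simp add: dirs)
  moreover have "path_of \<Lambda> = edge_segment \<Lambda> ?d \<union> (\<Union>c\<in>edge_dirs \<Lambda> - {?d}. edge_segment \<Lambda> c)"
    using path_of_flattest[of \<Lambda> ?d] flat p by simp
  ultimately show ?thesis
    unfolding N_def[symmetric] Y_def[symmetric] s_def[symmetric] sv[symmetric]
    by (simp only: image_Un image_UN Un_assoc)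
qed

lemma path_of_nonneg:
  assumes "(x, y) \<in> path_of \<Lambda>"
  shows "0 \<le> x"
proof -
  have "0 \<le> fst z" if "z \<in> edge_segment \<Lambda> c" for z c
  proof -
    have "0 \<le> fst (edge_start \<Lambda> c)" "0 \<le> fst (edge_vec \<Lambda> c)"
      by (simp_all add: edge_start_def edge_vec_def del: of_nat_sum)
    then show ?thesis
      using that by (auto simp: edge_segment_def closed_segment_def)
  qed
  then show ?thesis
    using assms by (fastforce simp: path_of_def simp flip: edge_segment_def)
qed

section \<open>Counting lattice points column by column\<close>

definition lattice_points :: "formal_product \<Rightarrow> (int \<times> int) set" where
  "lattice_points \<Lambda> = {(i, j). (real_of_int i, real_of_int j) \<in> region \<Lambda>}"

text \<open>The new segment bounds the region to the left of \<open>a\<close>, the translated path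
  bounds it from \<open>a\<close> on. The inequality of the line is multiplied by \<open>a\<close>,
  which suits the later integer count.\<close>

lemma region_add_flattest:
  fixes x y :: real
  assumes cop: "\<forall>q\<in>#add_mset p \<Lambda>. coprime (fst (orbit_dir q)) (snd (orbit_dir q))"
    and flat: "\<forall>q\<in>#\<Lambda>. \<not> flatter (orbit_dir q) (orbit_dir p)"
    and p: "orbit_dir p = (a, b)" and a: "0 < a"
  shows "(x, y) \<in> region (add_mset p \<Lambda>) \<longleftrightarrow>
    (if x < a then 0 \<le> x \<and> 0 \<le> y \<and> a * y + b * x \<le> a * (path_y \<Lambda> + b)
     else (x - a, y) \<in> region \<Lambda>)"
proof -
  define Y where "Y = real (path_y \<Lambda>)"
  have seg: "(x, z) \<in> closed_segment (0, Y + b) (a, Y) \<longleftrightarrow> 0 \<le> x \<and> x \<le> a \<and> a * z + b * x = a * (Y + b)" for z :: real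
  proof
    assume "(x, z) \<in> closed_segment (0, Y + b) (a, Y)"
    then obtain u :: real where u: "0 \<le> u" "u \<le> 1" "x = u * a" "z = Y + b - u * b"
      by (auto simp: closed_segment_def algebra_simps)
    have "u * a \<le> a" using u by (simp add: mult_left_le_one_le)
    then show "0 \<le> x \<and> x \<le> a \<and> a * z + b * x = a * (Y + b)"
      using u(1,2) unfolding u(3,4) by (simp add: algebra_simps)
  next
    assume "0 \<le> x \<and> x \<le> a \<and> a * z + b * x = a * (Y + b)"
    moreover from this have "z = Y + b - b * x / a" using a by (simp add: field_simps)
    ultimately show "(x, z) \<in> closed_segment (0, Y + b) (a, Y)"
      unfolding closed_segment_def using a
      by (intro CollectI exI[of _ "x / a"]) (auto simp: field_simps)
  qed
  have shift: "(x, z) \<in> (+) (real a, 0) ` path_of \<Lambda> \<longleftrightarrow> (x - a, z) \<in> path_of \<Lambda>" for z :: real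
    by (force simp: image_iff)
  have path: "(x, z) \<in> path_of (add_mset p \<Lambda>) \<longleftrightarrow>
      (0 \<le> x \<and> x \<le> a \<and> a * z + b * x = a * (Y + b)) \<or> (x - a, z) \<in> path_of \<Lambda>" for z :: real
    using path_of_add_flattest[OF cop flat p] seg[of z] shift[of z] by (simp add: Y_def)
  have start: "(0, Y) \<in> path_of \<Lambda>" by (simp add: path_of_def Y_def)
  show ?thesis
  proof (cases "x < a")
    case True
    \<comment> \<open>The translated path has no point to the left of \<open>a\<close>, so only the
      new segment remains.\<close>
    then have "(x, z) \<in> path_of (add_mset p \<Lambda>) \<longleftrightarrow> 0 \<le> x \<and> z = Y + b - b * x / a" for z :: real
      using path[of z] path_of_nonneg[of "x - a" z \<Lambda>] a by (auto simp: field_simps)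
    then have "(x, y) \<in> region (add_mset p \<Lambda>) \<longleftrightarrow> 0 \<le> x \<and> 0 \<le> y \<and> y \<le> Y + b - b * x / a"
      by (auto simp: region_def)
    also have "\<dots> \<longleftrightarrow> 0 \<le> x \<and> 0 \<le> y \<and> a * y + b * x \<le> a * (Y + b)"
      using a by (simp add: field_simps)
    finally show ?thesis using True by (simp add: Y_def)
  next
    case False
    \<comment> \<open>At \<open>x = a\<close> the segment ends in the translated initial point and
      contributes nothing new; this column belongs to the translate.\<close>
    have "(x, z) \<in> path_of (add_mset p \<Lambda>) \<longleftrightarrow> (x - a, z) \<in> path_of \<Lambda>" for z :: real
    proof -
      have "z = Y" if "x = a" "a * z + b * x = a * (Y + b)"
        using that a by (simp add: field_simps)
      then show ?thesis using path[of z] start False by auto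
    qed
    then show ?thesis using False by (auto simp: region_def)
  qed
qed

text \<open>For \<open>0 < i < a\<close> coprimality keeps \<open>b * i / a\<close> off the
  integers, so the floors at \<open>i\<close> and \<open>a - i\<close> add up to
  \<open>b - 1\<close>. The index 0 stands alone and gives \<open>b\<close>.\<close>

lemma sum_mult_div_coprime:
  fixes a b :: nat
  assumes "coprime a b" "0 < a"
  shows "2 * (\<Sum>i<a. int (b * (a - i) div a)) = (int a - 1) * (int b - 1) + 2 * int b"
proof -
  define g where "g i = int (b * i div a)" for i
  have pair: "g i + g (a - i) = int b - 1" if i: "i \<in> {1..<a}" for i
  proof -
    have "\<not> a dvd b * i"
      using assms i by (simp add: coprime_dvd_mult_right_iff nat_dvd_not_less)
    then have r: "b * i mod a > 0" by (simp add: mod_greater_zero_iff_not_dvd)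
    define q r' where "q = b * i div a" and "r' = b * i mod a"
    have e: "b * i = q * a + r'" "0 < r'" "r' < a" using r assms by (auto simp: q_def r'_def)
    have "int b * int i = int q * int a + int r'" using e by (metis of_nat_add of_nat_mult)
    then have "int (b * (a - i)) = (int b - 1 - int q) * int a + (int a - int r')"
      using i by (simp add: of_nat_diff algebra_simps)
    then have "int (b * (a - i)) div int a = int b - 1 - int q"
      using e by (intro int_div_pos_eq[of _ _ _ "int a - int r'"]) (auto simp: algebra_simps)
    then show ?thesis by (simp add: g_def q_def zdiv_int)
  qed
  have "(\<Sum>i<a. g (a - i)) = g a + (\<Sum>i\<in>{1..<a}. g (a - i))"
    using \<open>0 < a\<close> by (subst lessThan_atLeast0, subst sum.atLeast_Suc_lessThan) auto
  moreover have "(\<Sum>i\<in>{1..<a}. g (a - i)) = (\<Sum>i\<in>{1..<a}. g i)"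
    by (rule sum.reindex_bij_witness[of _ "\<lambda>i. a - i" "\<lambda>i. a - i"]) auto
  moreover have "(\<Sum>i\<in>{1..<a}. g i) + (\<Sum>i\<in>{1..<a}. g (a - i)) = (int a - 1) * (int b - 1)"
    unfolding sum.distrib[symmetric] using pair assms by (simp add: of_nat_diff)
  moreover have "g a = int b" using assms by (simp add: g_def)
  ultimately show ?thesis unfolding g_def by simp
qed

text \<open>The columns with abscissa below \<open>a\<close> are new, the rest is a translate of the
  old point set. Doubling avoids halves; finiteness is carried along because \<open>card\<close> is
  0 on infinite sets.\<close>

lemma lattice_points_add_flattest:
  assumes cop: "\<forall>q\<in>#add_mset p \<Lambda>. coprime (fst (orbit_dir q)) (snd (orbit_dir q))"
    and flat: "\<forall>q\<in>#\<Lambda>. \<not> flatter (orbit_dir q) (orbit_dir p)"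
    and p: "orbit_dir p = (a, b)" and a: "0 < a"
    and fin: "finite (lattice_points \<Lambda>)"
  shows "finite (lattice_points (add_mset p \<Lambda>)) \<and>
    2 * int (card (lattice_points (add_mset p \<Lambda>))) =
      2 * int (card (lattice_points \<Lambda>)) + 2 * int a * int (path_y \<Lambda>) + int a * int b + int a + int b + 1"
proof -
  define Y where "Y = path_y \<Lambda>"
  \<comment> \<open>Height of the highest lattice point in column \<open>i\<close>: the segment lies
    \<open>b * (a - i) / a\<close> above its right end, whose height is the integer
    \<open>Y\<close>.\<close>
  define h where "h i = Y + b * (a - i) div a" for i
  define C where "C = (\<lambda>(i, j). (int i, int j)) ` (SIGMA i:{..<a}. {..h i})"
  define T where "T = (\<lambda>(i, j). (i + int a, j)) ` lattice_points \<Lambda>"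
  have column: "(int i, j) \<in> lattice_points (add_mset p \<Lambda>) \<longleftrightarrow> 0 \<le> j \<and> nat j \<le> h i" if i: "i < a" for i j
  proof (cases "0 \<le> j")
    case True
    then obtain k where k: "j = int k" using nonneg_int_cases by blast
    have "real a * real k + real b * real i \<le> real a * (real Y + real b) \<longleftrightarrow> a * k + b * i \<le> a * (Y + b)"
      by (metis of_nat_add of_nat_le_iff of_nat_mult)
    also have "\<dots> \<longleftrightarrow> k * a \<le> Y * a + b * (a - i)"
    proof -
      have "b * a = b * (a - i) + b * i"
        using i by (simp flip: add_mult_distrib2)
      then show ?thesis by (simp only: distrib_left) (simp add: mult.commute)
    qed
    also have "\<dots> \<longleftrightarrow> k \<le> (Y * a + b * (a - i)) div a"
      by (rule less_eq_div_iff_mult_less_eq[OF a, symmetric])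
    also have "(Y * a + b * (a - i)) div a = h i"
      using a by (simp add: h_def)
    finally show ?thesis
      using i True k region_add_flattest[OF cop flat p a, of "real i" "real k"]
      by (simp add: lattice_points_def Y_def)
  qed (auto simp: lattice_points_def region_def)
  have "(i, j) \<in> lattice_points (add_mset p \<Lambda>) \<longleftrightarrow> (i, j) \<in> C \<union> T" for i j
  proof (cases "0 \<le> i \<and> i < int a")
    case True
    then have "i = int (nat i)" "nat i < a" by linarith+
    then obtain k where k: "i = int k" "k < a" by blast
    have "(i, j) \<notin> T" using True by (auto simp: T_def lattice_points_def region_def)
    moreover have "(i, j) \<in> C \<longleftrightarrow> 0 \<le> j \<and> nat j \<le> h k"
      unfolding C_def using k by (auto simp: image_iff intro!: bexI[of _ "nat j"])
    ultimately show ?thesis using column[of k j] k by simp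
  next
    case False
    then have "(i, j) \<notin> C" by (auto simp: C_def)
    moreover have "(i, j) \<in> T \<longleftrightarrow> (i - int a, j) \<in> lattice_points \<Lambda>"
      by (force simp: T_def)
    moreover have "(i, j) \<in> lattice_points (add_mset p \<Lambda>) \<longleftrightarrow> (i - int a, j) \<in> lattice_points \<Lambda>"
    proof (cases "i < int a")
      case True
      with False show ?thesis by (auto simp: lattice_points_def region_def)
    next
      case False
      then have "\<not> real_of_int i < real a" by linarith
      then show ?thesis
        using region_add_flattest[OF cop flat p a, of "real_of_int i" "real_of_int j"]
        by (simp add: lattice_points_def)
    qed
    ultimately show ?thesis by simp
  qed
  then have eq: "lattice_points (add_mset p \<Lambda>) = C \<union> T" by auto
  have "C \<inter> T = {}" by (auto simp: C_def T_def lattice_points_def region_def)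
  moreover have "finite C" "finite T" using fin by (auto simp: C_def T_def)
  moreover have "card T = card (lattice_points \<Lambda>)"
    unfolding T_def by (rule card_image) (auto simp: inj_on_def)
  \<comment> \<open>The successor accounts for the lattice point on the horizontal axis.\<close>
  moreover have "card C = (\<Sum>i<a. Suc (h i))"
    unfolding C_def by (subst card_image) (auto simp: inj_on_def)
  then have "2 * int (card C) = 2 * int a * (int Y + 1) + 2 * (\<Sum>i<a. int (b * (a - i) div a))"
    by (simp add: h_def sum.distrib algebra_simps)
  ultimately show ?thesis
    using sum_mult_div_coprime[of a b] cop p a
    by (simp add: eq card_Un_disjoint Y_def algebra_simps)
qed

section \<open>Pick's formula by induction on the number of factors\<close>

lemma mixed_area_add_flattest:
  assumes flat: "\<forall>q\<in>#\<Lambda>. \<not> flatter (orbit_dir q) (orbit_dir p)" and p: "orbit_dir p = (a, b)"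
  shows "mixed_area (add_mset p \<Lambda>) (add_mset p \<Lambda>) =
    mixed_area \<Lambda> \<Lambda> + 2 * int a * int (path_y \<Lambda>) + int a * int b"
proof -
  \<comment> \<open>Flatness decides every maximum in favour of \<open>a\<close>, so the cross terms
    sum to \<open>a\<close> times the height of the old path.\<close>
  have "max (a * snd (orbit_dir q)) (fst (orbit_dir q) * b) = a * snd (orbit_dir q)" if "q \<in># \<Lambda>" for q
    using flat that p by (auto simp: flatter_def case_prod_beta mult.commute not_less)
  then have "(\<Sum>q\<in>#\<Lambda>. int (max (a * snd (orbit_dir q)) (fst (orbit_dir q) * b)))
      = (\<Sum>q\<in>#\<Lambda>. int a * int (snd (orbit_dir q)))"
    by (intro arg_cong[where f = sum_mset] image_mset_cong) simp
  also have "\<dots> = int a * int (path_y \<Lambda>)"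
    unfolding path_y_eq by (induction \<Lambda>) (simp_all add: algebra_simps)
  finally show ?thesis
    by (simp add: mixed_area_def p sum_mset.distrib max.commute mult.commute)
qed

text \<open>Base case of the induction: the region degenerates to a vertical segment, or to the
  origin for the empty product, and there is no factor of positive width to split off.\<close>

lemma lattice_points_vertical:
  assumes vert: "\<forall>q\<in>#\<Lambda>. orbit_dir q = (0, 1)"
  shows "lattice_points \<Lambda> = {0} \<times> {0..int (size \<Lambda>)}"
proof -
  have "\<forall>q\<in>#\<Lambda>. \<not> flatter (orbit_dir q) (0, 1)" using vert by (simp add: flatter_def)
  note path = path_of_flattest[OF this] edge_start_flattest[OF this]
  have Y: "path_y \<Lambda> = size \<Lambda>" unfolding path_y_eq using vert by (induction \<Lambda>) auto
  have m: "edge_mult \<Lambda> (0, 1) = size \<Lambda>"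
    using vert by (induction \<Lambda>) (auto simp: edge_mult_add_mset, simp add: edge_mult_def)
  have dirs: "edge_dirs \<Lambda> - {(0, 1)} = {}" using vert by (auto simp: edge_dirs_eq)
  have P: "path_of \<Lambda> = closed_segment (0, real (size \<Lambda>)) (0, 0)"
    unfolding path(1) dirs by (simp add: edge_segment_def path(2) Y edge_vec_def m del: One_nat_def)
  have "(x, y) \<in> path_of \<Lambda> \<Longrightarrow> x = 0 \<and> y \<le> size \<Lambda>" for x y
    by (auto simp: P closed_segment_def mult_left_le_one_le)
  moreover have "(0, real (size \<Lambda>)) \<in> path_of \<Lambda>" by (simp add: P)
  ultimately have "(x, y) \<in> region \<Lambda> \<longleftrightarrow> x = 0 \<and> 0 \<le> y \<and> y \<le> size \<Lambda>" for x y
    by (auto simp: region_def) (metis order_trans)+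
  then show ?thesis by (auto simp: lattice_points_def)
qed

lemma exists_flattest:
  assumes "\<Lambda> \<noteq> {#}" and cop: "\<forall>q\<in>#\<Lambda>. coprime (fst (orbit_dir q)) (snd (orbit_dir q))"
  shows "\<exists>p\<in>#\<Lambda>. \<forall>q\<in>#\<Lambda>. \<not> flatter (orbit_dir q) (orbit_dir p)"
proof -
  \<comment> \<open>The quotient \<open>b / (a + b)\<close> orders directions by steepness like
    \<open>b / a\<close>, but its denominator is positive for the vertical direction too.\<close>
  define s where "s p = real (snd (orbit_dir p)) / real (fst (orbit_dir p) + snd (orbit_dir p))" for p
  obtain p where p: "p \<in># \<Lambda>" "\<forall>q\<in>#\<Lambda>. s p \<le> s q"
    using assms(1) ex_min_if_finite[of "s ` set_mset \<Lambda>"] by (force simp: not_less)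
  have "\<not> flatter (orbit_dir q) (orbit_dir p)" if q: "q \<in># \<Lambda>" for q
  proof
    obtain a b c d where ab: "orbit_dir p = (a, b)" "orbit_dir q = (c, d)" by fastforce
    have "coprime a b" "coprime c d" using cop p(1) q ab by force+
    then have "0 < a + b" "0 < c + d" by (auto intro!: Nat.gr0I)
    then have "0 < real a + real b" "0 < real c + real d" by linarith+
    moreover have "real b / (real a + real b) \<le> real d / (real c + real d)"
      using p(2) q ab by (force simp: s_def)
    ultimately have "real b * real c \<le> real d * real a" by (simp add: field_simps)
    moreover assume "flatter (orbit_dir q) (orbit_dir p)"
    then have "d * a < b * c" by (simp add: flatter_def ab)
    then have "real d * real a < real b * real c" by (metis of_nat_less_iff of_nat_mult)
    ultimately show False by simp
  qed
  then show ?thesis using p(1) by blast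
qed

theorem lattice_count_eq:
  assumes "\<forall>q\<in>#\<Lambda>. coprime (fst (orbit_dir q)) (snd (orbit_dir q))"
  shows "2 * (int (lattice_count \<Lambda>) - 1) = mixed_area \<Lambda> \<Lambda> + boundary_length \<Lambda>"
proof -
  have "finite (lattice_points \<Lambda>) \<and>
      2 * int (card (lattice_points \<Lambda>)) = mixed_area \<Lambda> \<Lambda> + boundary_length \<Lambda> + 2"
    using assms
  proof (induction "size \<Lambda>" arbitrary: \<Lambda> rule: less_induct)
    case less
    show ?case
    proof (cases "\<forall>q\<in>#\<Lambda>. orbit_dir q = (0, 1)")
      case True
      have "mixed_area \<Lambda> \<Lambda> = (\<Sum>p\<in>#\<Lambda>. \<Sum>q\<in>#\<Lambda>. 0)"
        unfolding mixed_area_def using True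
        by (intro arg_cong[where f = sum_mset] image_mset_cong) simp
      moreover have "boundary_length \<Lambda> = 2 * int (size \<Lambda>)"
        using True unfolding boundary_length_def by (induction \<Lambda>) auto
      ultimately show ?thesis by (simp add: lattice_points_vertical[OF True])
    next
      case False
      then have "\<Lambda> \<noteq> {#}" by auto
      then obtain p where p: "p \<in># \<Lambda>" "\<forall>q\<in>#\<Lambda>. \<not> flatter (orbit_dir q) (orbit_dir p)"
        using exists_flattest less.prems by blast
      obtain a b where ab: "orbit_dir p = (a, b)" by fastforce
      \<comment> \<open>If a flattest factor were vertical, all factors would be, which is the base
        case.\<close>
      have "0 < a"
      proof (rule Nat.gr0I)
        assume "a = 0"
        have "coprime a b" using less.prems p(1) ab by force
        then have b: "b = 1" using \<open>a = 0\<close> by simp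
        have "orbit_dir q = (0, 1)" if q: "q \<in># \<Lambda>" for q
        proof -
          obtain c d where cd: "orbit_dir q = (c, d)" by fastforce
          have "c = 0" using p(2) q cd ab \<open>a = 0\<close> b by (force simp: flatter_def)
          moreover have "coprime c d" using less.prems q cd by force
          ultimately show ?thesis using cd by simp
        qed
        with False show False by blast
      qed
      define M where "M = \<Lambda> - {#p#}"
      have \<Lambda>: "\<Lambda> = add_mset p M" using p(1) by (simp add: M_def)
      have cop: "\<forall>q\<in>#add_mset p M. coprime (fst (orbit_dir q)) (snd (orbit_dir q))"
        using less.prems unfolding \<Lambda> .
      have flat: "\<forall>q\<in>#M. \<not> flatter (orbit_dir q) (orbit_dir p)" using p(2) by (simp add: \<Lambda>)
      have IH: "finite (lattice_points M) \<and>
          2 * int (card (lattice_points M)) = mixed_area M M + boundary_length M + 2"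
        using cop by (intro less.hyps) (simp_all add: \<Lambda>)
      \<comment> \<open>Both sides grow by \<open>2 * a * path_y M + a * b + a + b + 1\<close>; the
        last three terms come from \<open>boundary_length\<close>.\<close>
      then show ?thesis
        using lattice_points_add_flattest[OF cop flat ab \<open>0 < a\<close>] mixed_area_add_flattest[OF flat ab]
        unfolding \<Lambda> by (simp add: boundary_length_def ab)
    qed
  qed
  then show ?thesis by (simp add: lattice_count_def lattice_points_def)
qed

section \<open>The index as a quadratic form plus a linear form\<close>

lemma card_h_edges:
  assumes "convex_generator \<Lambda>"
  shows "card (h_edges \<Lambda>) = size (filter_mset is_hyp \<Lambda>)"
proof -
  have hyps: "set_mset (filter_mset is_hyp \<Lambda>) = (\<lambda>(a, b). Hyp a b) ` h_edges \<Lambda>"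
  proof -
    have "p \<in># \<Lambda> \<and> is_hyp p \<longleftrightarrow> p \<in> (\<lambda>(a, b). Hyp a b) ` h_edges \<Lambda>" for p
      by (cases p) (auto simp: h_edges_def edge_dirs_def)
    then show ?thesis by auto
  qed
  \<comment> \<open>A convex generator repeats no hyperbolic symbol, so counting with multiplicity
    counts the edges labelled \<open>h\<close>.\<close>
  have "count (filter_mset is_hyp \<Lambda>) p = 1" if "p \<in># filter_mset is_hyp \<Lambda>" for p
    using that assms by (cases p) (auto simp: convex_generator_def)
  then have "size (filter_mset is_hyp \<Lambda>) = card (set_mset (filter_mset is_hyp \<Lambda>))"
    by (simp add: size_multiset_overloaded_eq)
  also have "\<dots> = card (h_edges \<Lambda>)"
    unfolding hyps by (rule card_image) (auto simp: inj_on_def)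
  finally show ?thesis by simp
qed

text \<open>Hyperbolic factors are counted with multiplicity, which makes this additive on arbitrary
  formal products.\<close>

definition linear_part :: "formal_product \<Rightarrow> int" where
  "linear_part \<Lambda> = boundary_length \<Lambda> - int (size (filter_mset is_hyp \<Lambda>))"

lemma ech_index_eq:
  assumes "convex_generator \<Lambda>"
  shows "ech_index \<Lambda> = mixed_area \<Lambda> \<Lambda> + linear_part \<Lambda>"
proof -
  have "coprime (fst (orbit_dir q)) (snd (orbit_dir q))" if "q \<in># \<Lambda>" for q
    using that assms by (cases q) (auto simp: convex_generator_def)
  then show ?thesis
    using lattice_count_eq[of \<Lambda>] card_h_edges[OF assms] by (simp add: ech_index_def linear_part_def)
qed

section \<open>Bilinearity and the index of a product\<close>

lemma mixed_area_add_left: "mixed_area (\<Lambda> + M) N = mixed_area \<Lambda> N + mixed_area M N"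
  by (simp add: mixed_area_def)

lemma mixed_area_add_right: "mixed_area N (\<Lambda> + M) = mixed_area N \<Lambda> + mixed_area N M"
  by (simp add: mixed_area_def sum_mset.distrib)

lemma mixed_area_commute: "mixed_area \<Lambda> M = mixed_area M \<Lambda>"
  unfolding mixed_area_def by (subst sum_mset.swap) (simp add: max.commute)

lemma mixed_area_sum: "mixed_area (\<Sum>i\<in>S. \<Lambda> i) (\<Sum>i\<in>S. \<Lambda> i) = (\<Sum>i\<in>S. \<Sum>j\<in>S. mixed_area (\<Lambda> i) (\<Lambda> j))"
proof -
  have "mixed_area {#} N = 0" "mixed_area N {#} = 0" for N by (simp_all add: mixed_area_def)
  then have "mixed_area (\<Sum>i\<in>S. \<Lambda> i) N = (\<Sum>i\<in>S. mixed_area (\<Lambda> i) N)"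
    "mixed_area N (\<Sum>i\<in>S. \<Lambda> i) = (\<Sum>i\<in>S. mixed_area N (\<Lambda> i))" for N
    by (induction S rule: infinite_finite_induct)
      (simp_all add: mixed_area_add_left mixed_area_add_right)
  then show ?thesis by simp (rule sum.swap)
qed

lemma linear_part_add: "linear_part (\<Lambda> + M) = linear_part \<Lambda> + linear_part M"
  by (simp add: linear_part_def boundary_length_def)

lemma linear_part_sum: "linear_part (\<Sum>i\<in>S. \<Lambda> i) = (\<Sum>i\<in>S. linear_part (\<Lambda> i))"
proof -
  have "linear_part {#} = 0" by (simp add: linear_part_def boundary_length_def)
  then show ?thesis
    by (induction S rule: infinite_finite_induct) (simp_all add: linear_part_add)
qed

text \<open>Polarization: the indices of two factors and of their product determine the mixed area
  of the two.\<close>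

lemma ech_index_add:
  assumes "convex_generator \<Lambda>" "convex_generator M" "no_common_hyperbolic \<Lambda> M"
  shows "ech_index (\<Lambda> + M) = ech_index \<Lambda> + ech_index M + 2 * mixed_area \<Lambda> M"
  using assms ech_index_eq[OF convex_generator_add[OF assms]] mixed_area_commute[of M \<Lambda>]
  by (simp add: ech_index_eq mixed_area_add_left mixed_area_add_right linear_part_add)

text \<open>In the expanded quadratic form each diagonal term joins the linear part to give the
  index of one factor, which leaves the mixed areas of distinct factors.\<close>

lemma ech_index_sum:
  assumes "finite S" "\<And>i. i \<in> S \<Longrightarrow> convex_generator (\<Lambda> i)"
    and "\<And>i j. i \<in> S \<Longrightarrow> j \<in> S \<Longrightarrow> i \<noteq> j \<Longrightarrow> no_common_hyperbolic (\<Lambda> i) (\<Lambda> j)"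
  shows "ech_index (\<Sum>i\<in>S. \<Lambda> i) =
    (\<Sum>i\<in>S. ech_index (\<Lambda> i) + (\<Sum>j\<in>S - {i}. mixed_area (\<Lambda> i) (\<Lambda> j)))"
proof -
  have "ech_index (\<Sum>i\<in>S. \<Lambda> i) =
      (\<Sum>i\<in>S. (\<Sum>j\<in>S. mixed_area (\<Lambda> i) (\<Lambda> j)) + linear_part (\<Lambda> i))"
    using ech_index_eq[OF convex_generator_sum[OF assms]]
    by (simp add: mixed_area_sum linear_part_sum sum.distrib)
  also have "\<dots> = (\<Sum>i\<in>S. ech_index (\<Lambda> i) + (\<Sum>j\<in>S - {i}. mixed_area (\<Lambda> i) (\<Lambda> j)))"
    by (rule sum.cong) (use assms in \<open>simp_all add: ech_index_eq sum.remove\<close>)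
  finally show ?thesis .
qed

theorem corollary1p20:
  fixes n :: nat and \<Lambda> \<Lambda>' :: "nat \<Rightarrow> formal_product" and S :: "nat set"
  assumes "\<And>i. i \<in> {1..n} \<Longrightarrow> convex_generator (\<Lambda> i)"
    and "\<And>i. i \<in> {1..n} \<Longrightarrow> convex_generator (\<Lambda>' i)"
    and "\<And>i j. i \<in> {1..n} \<Longrightarrow> j \<in> {1..n} \<Longrightarrow> i \<noteq> j \<Longrightarrow> no_common_hyperbolic (\<Lambda> i) (\<Lambda> j)"
    and "\<And>i j. i \<in> {1..n} \<Longrightarrow> j \<in> {1..n} \<Longrightarrow> i \<noteq> j \<Longrightarrow> no_common_hyperbolic (\<Lambda>' i) (\<Lambda>' j)"
    and "\<And>i. i \<in> {1..n} \<Longrightarrow> ech_index (\<Lambda> i) = ech_index (\<Lambda>' i)"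
    and "\<And>i j. i \<in> {1..n} \<Longrightarrow> j \<in> {1..n} \<Longrightarrow> i \<noteq> j \<Longrightarrow>
           ech_index (\<Lambda> i + \<Lambda> j) = ech_index (\<Lambda>' i + \<Lambda>' j)"
    and "S \<subseteq> {1..n}"
  shows "ech_index (\<Sum>i\<in>S. \<Lambda> i) = ech_index (\<Sum>i\<in>S. \<Lambda>' i)"
proof -
  have "finite S" using assms(7) by (rule finite_subset) simp
  have in_n: "i \<in> {1..n}" if "i \<in> S" for i using assms(7) that by blast
  \<comment> \<open>All indices in \<open>ech_index_add\<close> agree for the two families, and the
    factor 2 cancels over the integers.\<close>
  have mixed: "mixed_area (\<Lambda> i) (\<Lambda> j) = mixed_area (\<Lambda>' i) (\<Lambda>' j)"
    if "i \<in> S" "j \<in> S - {i}" for i j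
    using ech_index_add[of "\<Lambda> i" "\<Lambda> j"] ech_index_add[of "\<Lambda>' i" "\<Lambda>' j"] that in_n[of i] in_n[of j]
      assms(1,2,5)[of i] assms(1,2,5)[of j] assms(3,4,6)[of i j] by auto
  have "ech_index (\<Sum>i\<in>S. \<Lambda> i) =
      (\<Sum>i\<in>S. ech_index (\<Lambda> i) + (\<Sum>j\<in>S - {i}. mixed_area (\<Lambda> i) (\<Lambda> j)))"
    using \<open>finite S\<close> in_n assms(1,3) by (intro ech_index_sum) auto
  also have "\<dots> = (\<Sum>i\<in>S. ech_index (\<Lambda>' i) + (\<Sum>j\<in>S - {i}. mixed_area (\<Lambda>' i) (\<Lambda>' j)))"
    using in_n assms(5) mixed by (intro sum.cong arg_cong2[where f = "(+)"]) auto
  also have "\<dots> = ech_index (\<Sum>i\<in>S. \<Lambda>' i)"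
    using \<open>finite S\<close> in_n assms(2,4) by (intro ech_index_sum[symmetric]) auto
  finally show ?thesis .
qed

end
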